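(* Let $A_{\Gamma}$ be any Artin group. If $\Gamma$ contains an even-labelled leaf, then: (1) there are automorphisms of $A_{\Gamma}$ that do not preserve the set of spherical parabolic subgroups of $A_\Gamma$; (2) $A_{\Gamma}$ is not co-Hopfian.
   Context: A defining graph is a finite simplicial graph $\Gamma$ with vertex set $V(\Gamma)$, each of whose edges $e^{ab}$ (joining adjacent vertices $a,b$) carries an integer label (coefficient) $m_{ab}\ge 2$. The Artin group of $\Gamma$ is $A_{\Gamma}=\langle V(\Gamma)\mid \underbrace{aba\cdots}_{m_{ab}}=\underbrace{bab\cdots}_{m_{ab}}\text{ for every edge } e^{ab}\rangle$, and its Coxeter group $W_\Gamma$ is obtained by adding the relations $s^2=1$, $s\in V(\Gamma)$. For an induced subgraph $\Gamma_1\subseteq\Gamma$, the subgroup generated by $V(\Gamma_1)$ is (naturally isomorphic to) $A_{\Gamma_1}$ and is called a standard parabolic subgroup; conjugates $gA_{\Gamma_1}g^{-1}$ are called parabolic subgroups; such a subgroup is spherical if $W_{\Gamma_1}$ is finite. A leaf of $\Gamma$ is an edge $e^{ab}$ one of whose endpoints is contained in no other edge; it is even-labelled if $m_{ab}$ is even. A group is co-Hopfian if every injective endomorphism of it is surjective. *)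

theory Defs
  imports "HOL-Algebra.Generated_Groups"
begin

section \<open>Groups given by generators and relations\<close>

text \<open>
  A letter \<open>(s, True)\<close> stands for the generator \<open>s\<close>, and \<open>(s, False)\<close> for its formal inverse.
  A relation \<open>(l, r)\<close> is a pair of words, to be read as \<open>l = r\<close>.
\<close>

type_synonym 'a word = "('a \<times> bool) list"

abbreviation words :: "'a set \<Rightarrow> 'a word set" where
  "words S \<equiv> lists (S \<times> UNIV)"

inductive_set pres_eq :: "'a set \<Rightarrow> ('a word \<times> 'a word) set \<Rightarrow> ('a word \<times> 'a word) set"
  for S R where
  refl: "u \<in> words S \<Longrightarrow> (u, u) \<in> pres_eq S R"
| sym: "(u, v) \<in> pres_eq S R \<Longrightarrow> (v, u) \<in> pres_eq S R"
| trans: "(u, v) \<in> pres_eq S R \<Longrightarrow> (v, w) \<in> pres_eq S R \<Longrightarrow> (u, w) \<in> pres_eq S R"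
| cancel: "u \<in> words S \<Longrightarrow> v \<in> words S \<Longrightarrow> s \<in> S \<Longrightarrow>
    (u @ [(s, b), (s, \<not> b)] @ v, u @ v) \<in> pres_eq S R"
| relator: "u \<in> words S \<Longrightarrow> v \<in> words S \<Longrightarrow> (l, r) \<in> R \<Longrightarrow> l \<in> words S \<Longrightarrow> r \<in> words S \<Longrightarrow>
    (u @ l @ v, u @ r @ v) \<in> pres_eq S R"

definition presented_group :: "'a set \<Rightarrow> ('a word \<times> 'a word) set \<Rightarrow> 'a word set monoid" where
  "presented_group S R =
    \<lparr>carrier = words S // pres_eq S R,
     monoid.mult = (\<lambda>A B. \<Union>u\<in>A. \<Union>v\<in>B. pres_eq S R `` {u @ v}),
     one = pres_eq S R `` {[]}\<rparr>"

definition pres_gen :: "'a set \<Rightarrow> ('a word \<times> 'a word) set \<Rightarrow> 'a \<Rightarrow> 'a word set" where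
  "pres_gen S R s = pres_eq S R `` {[(s, True)]}"

lemma pres_eq_words:
  "(u, v) \<in> pres_eq S R \<Longrightarrow> u \<in> words S \<and> v \<in> words S"
  by (induction rule: pres_eq.induct) auto

lemma equiv_pres_eq: "equiv (words S) (pres_eq S R)"
proof (rule equivI)
  show "pres_eq S R \<subseteq> words S \<times> words S"
    by (auto dest: pres_eq_words)
  show "refl_on (words S) (pres_eq S R)"
    by (auto simp: refl_on_def intro: pres_eq.refl)
  show "Relation.sym (pres_eq S R)"
    by (rule symI) (rule pres_eq.sym)
  show "Relation.trans (pres_eq S R)"
    by (rule transI) (rule pres_eq.trans)
qed

lemma pres_eq_append_left:
  "(u, v) \<in> pres_eq S R \<Longrightarrow> w \<in> words S \<Longrightarrow> (w @ u, w @ v) \<in> pres_eq S R"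
proof (induction rule: pres_eq.induct)
  case (cancel u v s b)
  then show ?case using pres_eq.cancel[of "w @ u" S v s b R] by simp
next
  case (relator u v l r)
  then show ?case using pres_eq.relator[of "w @ u" S v l r R] by simp
next
  case (trans u v w')
  then show ?case by (meson pres_eq.trans)
qed (simp_all add: pres_eq.refl pres_eq.sym)

lemma pres_eq_append_right:
  "(u, v) \<in> pres_eq S R \<Longrightarrow> w \<in> words S \<Longrightarrow> (u @ w, v @ w) \<in> pres_eq S R"
proof (induction rule: pres_eq.induct)
  case (cancel u v s b)
  then show ?case using pres_eq.cancel[of u S "v @ w" s b R] by simp
next
  case (relator u v l r)
  then show ?case using pres_eq.relator[of u S "v @ w" l r R] by simp
next
  case (trans u v w')
  then show ?case by (meson pres_eq.trans)
qed (simp_all add: pres_eq.refl pres_eq.sym)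

lemma pres_eq_append:
  assumes "(u, u') \<in> pres_eq S R" "(v, v') \<in> pres_eq S R"
  shows "(u @ v, u' @ v') \<in> pres_eq S R"
proof (rule pres_eq.trans)
  show "(u @ v, u' @ v) \<in> pres_eq S R"
    using pres_eq_append_right[OF assms(1)] pres_eq_words[OF assms(2)] by simp
  show "(u' @ v, u' @ v') \<in> pres_eq S R"
    using pres_eq_append_left[OF assms(2)] pres_eq_words[OF assms(1)] by simp
qed

lemma presented_group_mult_class:
  assumes "u \<in> words S" "v \<in> words S"
  shows "(pres_eq S R `` {u}) \<otimes>\<^bsub>presented_group S R\<^esub> (pres_eq S R `` {v}) = pres_eq S R `` {u @ v}"
proof -
  have "pres_eq S R `` {u' @ v'} = pres_eq S R `` {u @ v}"
    if "u' \<in> pres_eq S R `` {u}" "v' \<in> pres_eq S R `` {v}" for u' v'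
    using equiv_class_eq[OF equiv_pres_eq pres_eq_append] that by (metis Image_singleton_iff)
  then have "(\<Union>u'\<in>pres_eq S R `` {u}. \<Union>v'\<in>pres_eq S R `` {v}. pres_eq S R `` {u' @ v'}) =
      (\<Union>u'\<in>pres_eq S R `` {u}. \<Union>v'\<in>pres_eq S R `` {v}. pres_eq S R `` {u @ v})"
    by (intro SUP_cong HOL.refl) blast
  also have "\<dots> = pres_eq S R `` {u @ v}"
    using assms by (blast intro: pres_eq.refl)
  finally show ?thesis
    by (simp add: presented_group_def)
qed

definition inv_word :: "'a word \<Rightarrow> 'a word" where
  "inv_word w = rev (map (\<lambda>(s, b). (s, \<not> b)) w)"

lemma inv_word_in_words: "w \<in> words S \<Longrightarrow> inv_word w \<in> words S"
  by (induction w) (auto simp: inv_word_def)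

lemma pres_eq_inv_word: "w \<in> words S \<Longrightarrow> (inv_word w @ w, []) \<in> pres_eq S R"
proof (induction w)
  case Nil
  then show ?case by (simp add: inv_word_def pres_eq.refl)
next
  case (Cons x w)
  obtain s b where x: "x = (s, b)" by force
  have "(inv_word w @ [(s, \<not> b), (s, \<not> \<not> b)] @ w, inv_word w @ w) \<in> pres_eq S R"
    using Cons x by (intro pres_eq.cancel inv_word_in_words) auto
  moreover have "(inv_word w @ w, []) \<in> pres_eq S R"
    using Cons by simp
  ultimately have "(inv_word w @ [(s, \<not> b), (s, \<not> \<not> b)] @ w, []) \<in> pres_eq S R"
    by (rule pres_eq.trans)
  then show ?case
    by (simp add: inv_word_def x)
qed

lemma group_presented_group: "group (presented_group S R)"
proof (rule groupI)
  let ?G = "presented_group S R"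
  have cl: "pres_eq S R `` {u} \<in> carrier ?G" if "u \<in> words S" for u
    using that by (simp add: presented_group_def quotientI)
  have ex: "\<exists>u\<in>words S. x = pres_eq S R `` {u}" if "x \<in> carrier ?G" for x
    using that by (auto simp: presented_group_def elim: quotientE)
  have one: "\<one>\<^bsub>?G\<^esub> = pres_eq S R `` {[]}"
    by (simp add: presented_group_def)
  show "\<one>\<^bsub>?G\<^esub> \<in> carrier ?G"
    using cl[of "[]"] by (simp add: one)
  fix x assume "x \<in> carrier ?G"
  then obtain u where u: "u \<in> words S" "x = pres_eq S R `` {u}" using ex by blast
  show "\<one>\<^bsub>?G\<^esub> \<otimes>\<^bsub>?G\<^esub> x = x"
    using u presented_group_mult_class[of "[]" S u R] by (simp add: one)
  show "\<exists>y\<in>carrier ?G. y \<otimes>\<^bsub>?G\<^esub> x = \<one>\<^bsub>?G\<^esub>"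
  proof
    show "pres_eq S R `` {inv_word u} \<in> carrier ?G"
      using cl inv_word_in_words u by blast
    show "pres_eq S R `` {inv_word u} \<otimes>\<^bsub>?G\<^esub> x = \<one>\<^bsub>?G\<^esub>"
      using presented_group_mult_class[OF inv_word_in_words[OF u(1)] u(1), of R]
        equiv_class_eq[OF equiv_pres_eq pres_eq_inv_word[OF u(1)], of R]
      by (simp add: u one)
  qed
  fix y assume "y \<in> carrier ?G"
  then obtain v where v: "v \<in> words S" "y = pres_eq S R `` {v}" using ex by blast
  show "x \<otimes>\<^bsub>?G\<^esub> y \<in> carrier ?G"
    using presented_group_mult_class[OF u(1) v(1), of R] cl[of "u @ v"] u v by simp
  fix z assume "z \<in> carrier ?G"
  then obtain w where w: "w \<in> words S" "z = pres_eq S R `` {w}" using ex by blast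
  show "x \<otimes>\<^bsub>?G\<^esub> y \<otimes>\<^bsub>?G\<^esub> z = x \<otimes>\<^bsub>?G\<^esub> (y \<otimes>\<^bsub>?G\<^esub> z)"
    using u v w by (simp add: presented_group_mult_class)
qed

section \<open>Defining graphs, Artin groups and Coxeter groups\<close>

text \<open>
  Edges are two-element sets of vertices, so the labelling is symmetric by construction;
  its values outside the edge set are irrelevant.
\<close>

record 'v labelled_graph =
  verts :: "'v set"
  edges :: "'v set set"
  label :: "'v set \<Rightarrow> nat"

definition defining_graph :: "'v labelled_graph \<Rightarrow> bool" where
  "defining_graph \<Gamma> \<longleftrightarrow> finite (verts \<Gamma>) \<and>
    (\<forall>e\<in>edges \<Gamma>. e \<subseteq> verts \<Gamma> \<and> card e = 2 \<and> label \<Gamma> e \<ge> 2)"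

definition induced_subgraph :: "'v labelled_graph \<Rightarrow> 'v set \<Rightarrow> 'v labelled_graph" where
  "induced_subgraph \<Gamma> U = \<lparr>verts = U, edges = {e \<in> edges \<Gamma>. e \<subseteq> U}, label = label \<Gamma>\<rparr>"

definition is_leaf :: "'v labelled_graph \<Rightarrow> 'v set \<Rightarrow> bool" where
  "is_leaf \<Gamma> e \<longleftrightarrow> e \<in> edges \<Gamma> \<and> (\<exists>a\<in>e. \<forall>e'\<in>edges \<Gamma>. a \<in> e' \<longrightarrow> e' = e)"

fun alt_word :: "'v \<Rightarrow> 'v \<Rightarrow> nat \<Rightarrow> 'v word" where
  "alt_word a b 0 = []"
| "alt_word a b (Suc n) = (a, True) # alt_word b a n"

definition artin_relations :: "'v labelled_graph \<Rightarrow> ('v word \<times> 'v word) set" where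
  "artin_relations \<Gamma> =
    {(alt_word a b (label \<Gamma> {a, b}), alt_word b a (label \<Gamma> {a, b})) | a b. {a, b} \<in> edges \<Gamma>}"

definition artin_group :: "'v labelled_graph \<Rightarrow> 'v word set monoid" where
  "artin_group \<Gamma> = presented_group (verts \<Gamma>) (artin_relations \<Gamma>)"

definition coxeter_group :: "'v labelled_graph \<Rightarrow> 'v word set monoid" where
  "coxeter_group \<Gamma> = presented_group (verts \<Gamma>)
    (artin_relations \<Gamma> \<union> {([(s, True), (s, True)], []) | s. s \<in> verts \<Gamma>})"

definition artin_gen :: "'v labelled_graph \<Rightarrow> 'v \<Rightarrow> 'v word set" where
  "artin_gen \<Gamma> = pres_gen (verts \<Gamma>) (artin_relations \<Gamma>)"

section \<open>Parabolic subgroups\<close>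

definition standard_parabolic :: "'v labelled_graph \<Rightarrow> 'v set \<Rightarrow> 'v word set set" where
  "standard_parabolic \<Gamma> U = generate (artin_group \<Gamma>) (artin_gen \<Gamma> ` U)"

definition spherical_parabolic_subgroups :: "'v labelled_graph \<Rightarrow> 'v word set set set" where
  "spherical_parabolic_subgroups \<Gamma> =
    {g <#\<^bsub>artin_group \<Gamma>\<^esub> standard_parabolic \<Gamma> U #>\<^bsub>artin_group \<Gamma>\<^esub> inv\<^bsub>artin_group \<Gamma>\<^esub> g | g U.
      g \<in> carrier (artin_group \<Gamma>) \<and> U \<subseteq> verts \<Gamma> \<and>
      finite (carrier (coxeter_group (induced_subgraph \<Gamma> U)))}"

definition co_Hopfian :: "('a, 'b) monoid_scheme \<Rightarrow> bool" where
  "co_Hopfian G \<longleftrightarrow>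
    (\<forall>\<phi>\<in>hom G G. inj_on \<phi> (carrier G) \<longrightarrow> \<phi> ` carrier G = carrier G)"

end

theory Submission
  imports Defs "HOL-Algebra.Elementary_Groups"
begin

text \<open>
  Let \<open>{a, b}\<close> be the leaf, \<open>a\<close> its free endpoint, \<open>2 n\<close> its label, and \<open>x = a b\<close>. The leaf relation
  says that \<open>x ^ n\<close> commutes with \<open>b\<close>, and \<open>a\<close> lies on no other edge, so for every \<open>k\<close> there is an endomorphism that sends \<open>x\<close> to
  \<open>x ^ k\<close> and fixes all generators other than \<open>a\<close>.

  For \<open>k = -1\<close> it is an involution, and it sends \<open>a\<close> to the inverse of \<open>b a b\<close>. The exponent-sum
  homomorphism to the integers takes only multiples of 3 on the image of the subgroup generated by
  \<open>a\<close>, but takes the value 1 on all conjugates of generators.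

  For \<open>k = N = n + 1\<close> it multiplies the exponent sum of \<open>a\<close> by \<open>N\<close>, so it is not surjective. For
  injectivity, let \<open>K\<close> be the normal closure of the generators other than \<open>a\<close>, i.e. the kernel of the
  exponent sum of \<open>a\<close>. It is generated by the conjugates \<open>v_i\<close> of the \<open>v \<noteq> a\<close> by \<open>x ^ i\<close>, subject to
  the relations between the \<open>v \<noteq> a\<close> for each \<open>i\<close> and to \<open>b_(i + n) = b_i\<close>, and the endomorphism acts
  on it by \<open>v_i \<mapsto> v_(N i)\<close>. If \<open>s (N i) = i\<close> and \<open>s i\<close> is congruent to \<open>i\<close> modulo \<open>n\<close>, then
  \<open>v_i \<mapsto> v_(s i)\<close> is a left inverse. The map \<open>\<theta>\<close> below extends this left inverse to the whole group
  by recording all shifts of \<open>s\<close> at once.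
\<close>

section \<open>Homomorphisms out of presented groups\<close>

definition word_eval :: "('b, 'c) monoid_scheme \<Rightarrow> ('a \<Rightarrow> 'b) \<Rightarrow> 'a word \<Rightarrow> 'b" where
  "word_eval H f w = foldr (\<lambda>(s, c) y. (if c then f s else inv\<^bsub>H\<^esub> f s) \<otimes>\<^bsub>H\<^esub> y) w \<one>\<^bsub>H\<^esub>"

lemma word_eval_Nil [simp]: "word_eval H f [] = \<one>\<^bsub>H\<^esub>"
  by (simp add: word_eval_def)

lemma word_eval_Cons [simp]:
  "word_eval H f ((s, c) # w) = (if c then f s else inv\<^bsub>H\<^esub> f s) \<otimes>\<^bsub>H\<^esub> word_eval H f w"
  by (simp add: word_eval_def)

lemma word_eval_cong:
  "(\<And>s c. (s, c) \<in> set w \<Longrightarrow> f s = g s) \<Longrightarrow> word_eval H f w = word_eval H g w"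
  by (induction w) (auto split: if_splits, (metis (full_types))+)

lemma (in group) word_eval_closed [simp]:
  "f \<in> S \<rightarrow> carrier G \<Longrightarrow> w \<in> words S \<Longrightarrow> word_eval G f w \<in> carrier G"
  by (induction w) (auto simp: Pi_iff)

lemma (in group) word_eval_append:
  assumes "f \<in> S \<rightarrow> carrier G" "u \<in> words S" "v \<in> words S"
  shows "word_eval G f (u @ v) = word_eval G f u \<otimes> word_eval G f v"
  using assms(2)
proof (induction u)
  case Nil
  then show ?case using word_eval_closed[OF assms(1,3)] by simp
next
  case (Cons x u)
  then show ?case
    using assms word_eval_closed[OF assms(1)] by (cases x) (auto simp: m_assoc Pi_iff)
qed

lemma (in group) word_eval_pres_eq:
  assumes f: "f \<in> S \<rightarrow> carrier G"
    and R: "\<And>l r. (l, r) \<in> R \<Longrightarrow> word_eval G f l = word_eval G f r"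
    and "(u, v) \<in> pres_eq S R"
  shows "word_eval G f u = word_eval G f v"
  using assms(3)
proof (induction rule: pres_eq.induct)
  case (cancel u v s b)
  have s: "f s \<in> carrier G" using f cancel by blast
  have v: "word_eval G f v \<in> carrier G" using word_eval_closed[OF f] cancel by blast
  have "word_eval G f ([(s, b), (s, \<not> b)] @ v) = word_eval G f v"
    using s v by (simp flip: m_assoc)
  then show ?case
    using cancel by (simp add: word_eval_append[OF f] del: word_eval_Cons append_Cons append_Nil)
next
  case (relator u v l r)
  then show ?case by (simp add: word_eval_append[OF f] R)
qed auto

lemma pres_class_carrier: "w \<in> words S \<Longrightarrow> pres_eq S R `` {w} \<in> carrier (presented_group S R)"
  by (simp add: presented_group_def quotientI)

lemma pres_gen_carrier: "s \<in> S \<Longrightarrow> pres_gen S R s \<in> carrier (presented_group S R)"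
  by (simp add: pres_gen_def pres_class_carrier)

lemma presented_group_cases:
  assumes "x \<in> carrier (presented_group S R)"
  obtains w where "w \<in> words S" "x = pres_eq S R `` {w}"
  using assms by (auto simp: presented_group_def quotient_def)

lemma pres_inv_gen:
  assumes "s \<in> S"
  shows "inv\<^bsub>presented_group S R\<^esub> pres_gen S R s = pres_eq S R `` {[(s, False)]}"
proof -
  interpret group "presented_group S R" by (rule group_presented_group)
  have "([] @ [(s, False), (s, \<not> False)] @ [], [] @ []) \<in> pres_eq S R"
    using assms by (intro pres_eq.cancel) auto
  then have "pres_eq S R `` {[(s, False), (s, True)]} = pres_eq S R `` {[]}"
    using equiv_class_eq[OF equiv_pres_eq] by fastforce
  then have "pres_eq S R `` {[(s, False)]} \<otimes>\<^bsub>presented_group S R\<^esub> pres_gen S R s = \<one>\<^bsub>presented_group S R\<^esub>"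
    using assms by (simp add: pres_gen_def presented_group_mult_class) (simp add: presented_group_def)
  then show ?thesis
    using assms by (intro inv_equality pres_gen_carrier pres_class_carrier) auto
qed

lemma hom_pres_class:
  assumes "group H" "h \<in> hom (presented_group S R) H" "w \<in> words S"
  shows "h (pres_eq S R `` {w}) = word_eval H (\<lambda>s. h (pres_gen S R s)) w"
proof -
  interpret group_hom "presented_group S R" H h
    using assms group_presented_group by (simp add: group_hom_def group_hom_axioms_def)
  show ?thesis
    using assms(3)
  proof (induction w)
    case Nil
    then show ?case using hom_one by (simp add: presented_group_def)
  next
    case (Cons x w)
    obtain s c where x: "x = (s, c)" by force
    have s: "s \<in> S" using Cons x by auto
    have "pres_eq S R `` {x # w} = pres_eq S R `` {[x]} \<otimes>\<^bsub>presented_group S R\<^esub> pres_eq S R `` {w}"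
      using Cons presented_group_mult_class[of "[x]" S w R] by simp
    moreover have "pres_eq S R `` {[x]} =
        (if c then pres_gen S R s else inv\<^bsub>presented_group S R\<^esub> pres_gen S R s)"
      using pres_inv_gen[OF s, of R] by (simp add: x pres_gen_def)
    ultimately show ?case
      using Cons s by (simp add: x pres_class_carrier pres_gen_carrier)
  qed
qed

lemma presented_group_eval:
  assumes "w \<in> words S"
  shows "word_eval (presented_group S R) (pres_gen S R) w = pres_eq S R `` {w}"
  proof -
  have "(\<lambda>x. x) \<in> hom (presented_group S R) (presented_group S R)" by (simp add: hom_def)
  from hom_pres_class[OF group_presented_group this assms] show ?thesis by simp
qed

lemma presented_group_hom_ext:
  assumes "group H" "h \<in> hom (presented_group S R) H" "k \<in> hom (presented_group S R) H"
    and "\<And>s. s \<in> S \<Longrightarrow> h (pres_gen S R s) = k (pres_gen S R s)"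
    and "x \<in> carrier (presented_group S R)"
  shows "h x = k x"
proof -
  obtain w where w: "w \<in> words S" "x = pres_eq S R `` {w}"
    using assms(5) by (rule presented_group_cases)
  have "word_eval H (\<lambda>s. h (pres_gen S R s)) w = word_eval H (\<lambda>s. k (pres_gen S R s)) w"
    using w(1) assms(4) by (intro word_eval_cong) auto
  then show ?thesis using w assms by (simp add: hom_pres_class)
qed

lemma presented_group_lift:
  assumes "group H" and f: "f \<in> S \<rightarrow> carrier H"
    and R: "\<And>l r. (l, r) \<in> R \<Longrightarrow> word_eval H f l = word_eval H f r"
  obtains h where "h \<in> hom (presented_group S R) H" "\<And>s. s \<in> S \<Longrightarrow> h (pres_gen S R s) = f s"
proof -
  interpret H: group H by fact
  \<comment> \<open>\<open>word_eval H f\<close> is constant on each class, so its image of a class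
    is a singleton and \<open>the_elem\<close> picks the common value.\<close>
  define h where "h X = the_elem (word_eval H f ` X)" for X
  have h: "h (pres_eq S R `` {w}) = word_eval H f w" if "w \<in> words S" for w
  proof -
    have "word_eval H f u = word_eval H f w" if "(w, u) \<in> pres_eq S R" for u
      using H.word_eval_pres_eq[OF f R that] by simp
    then have "word_eval H f ` (pres_eq S R `` {w}) = {word_eval H f w}"
      using pres_eq.refl[OF that, of R] by blast
    then show ?thesis by (simp add: h_def)
  qed
  show thesis
  proof
    show "h \<in> hom (presented_group S R) H"
    proof (rule homI)
      fix x y assume "x \<in> carrier (presented_group S R)" "y \<in> carrier (presented_group S R)"
      then obtain u v where "u \<in> words S" "x = pres_eq S R `` {u}" "v \<in> words S" "y = pres_eq S R `` {v}"
        by (metis presented_group_cases)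
      then show "h x \<in> carrier H" "h (x \<otimes>\<^bsub>presented_group S R\<^esub> y) = h x \<otimes>\<^bsub>H\<^esub> h y"
        by (simp_all add: presented_group_mult_class h H.word_eval_closed[OF f] H.word_eval_append[OF f])
    qed
    show "h (pres_gen S R s) = f s" if "s \<in> S" for s
      using that f by (auto simp: pres_gen_def h Pi_iff)
  qed
qed

section \<open>Powers in groups\<close>

lemma (in group) mult_pow_rotate:
  fixes n :: nat
  assumes "x \<in> carrier G" "y \<in> carrier G"
  shows "y \<otimes> (x \<otimes> y) [^] n = (y \<otimes> x) [^] n \<otimes> y"
proof (induction n)
  case (Suc n)
  have "y \<otimes> (x \<otimes> y) [^] Suc n = (y \<otimes> (x \<otimes> y) [^] n) \<otimes> (x \<otimes> y)"
    using assms by (simp add: m_assoc)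
  also have "\<dots> = (y \<otimes> x) [^] Suc n \<otimes> y"
    unfolding Suc using assms by (simp add: m_assoc)
  finally show ?case .
qed (use assms in simp)

text \<open>An even braid relation becomes a commutation relation: by rotation (y x)^n y = y (x
  y)^n, and y can be cancelled on the right.\<close>

lemma (in group) mult_pow_eq_iff_commute:
  fixes n :: nat
  assumes "x \<in> carrier G" "y \<in> carrier G"
  shows "(x \<otimes> y) [^] n = (y \<otimes> x) [^] n \<longleftrightarrow> (x \<otimes> y) [^] n \<otimes> y = y \<otimes> (x \<otimes> y) [^] n"
  unfolding mult_pow_rotate[OF assms] using assms by (intro right_cancel[symmetric]) auto

lemma (in group) inv_commute:
  assumes "x \<in> carrier G" "y \<in> carrier G" "x \<otimes> y = y \<otimes> x"
  shows "inv x \<otimes> y = y \<otimes> inv x"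
proof -
  have "inv x \<otimes> y = inv x \<otimes> (y \<otimes> x) \<otimes> inv x"
    using assms(1,2) by (simp add: m_assoc)
  also have "\<dots> = y \<otimes> inv x"
    unfolding assms(3)[symmetric] using assms(1,2) by (simp flip: m_assoc)
  finally show ?thesis .
qed

lemma (in group) int_pow_commute:
  fixes k :: int
  assumes "x \<in> carrier G" "y \<in> carrier G" "x \<otimes> y = y \<otimes> x"
  shows "x [^] k \<otimes> y = y \<otimes> x [^] k"
proof -
  have "x [^] n \<otimes> y = y \<otimes> x [^] n" for n :: nat
    using assms by (intro group_commutes_pow)
  then show ?thesis
    using inv_commute[OF _ assms(2)] assms(1)
    by (cases k rule: int_cases2) (simp_all add: int_pow_int int_pow_neg_int)
qed

lemma (in group) word_eval_alt_word_double:
  assumes "f p \<in> carrier G" "f q \<in> carrier G"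
  shows "word_eval G f (alt_word p q (2 * n)) = (f p \<otimes> f q) [^] n"
proof (induction n)
  case (Suc n)
  have "alt_word p q (2 * Suc n) = (p, True) # (q, True) # alt_word p q (2 * n)"
    by simp
  with Suc have "word_eval G f (alt_word p q (2 * Suc n)) = f p \<otimes> (f q \<otimes> (f p \<otimes> f q) [^] n)"
    by simp
  also have "\<dots> = (f p \<otimes> f q) [^] Suc n"
    using assms by (subst nat_pow_Suc2) (simp_all add: m_assoc)
  finally show ?case .
qed simp

lemma set_alt_word: "set (alt_word p q k) \<subseteq> {(p, True), (q, True)}"
  by (induction p q k rule: alt_word.induct) auto

lemma alt_word_words: "p \<in> S \<Longrightarrow> q \<in> S \<Longrightarrow> alt_word p q k \<in> words S"
  by (induction p q k rule: alt_word.induct) auto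

section \<open>Sequences over a group, extended by the shift\<close>

definition shift_group :: "('a, 'b) monoid_scheme \<Rightarrow> ((int \<Rightarrow> 'a) \<times> int) monoid" where
  "shift_group G = \<lparr>carrier = {F. \<forall>i. F i \<in> carrier G} \<times> UNIV,
     monoid.mult = (\<lambda>(F, k) (E, l). (\<lambda>i. F i \<otimes>\<^bsub>G\<^esub> E (i + k), k + l)),
     one = (\<lambda>_. \<one>\<^bsub>G\<^esub>, 0)\<rparr>"

lemma shift_group_simps [simp]:
  "(F, k) \<in> carrier (shift_group G) \<longleftrightarrow> (\<forall>i. F i \<in> carrier G)"
  "(F, k) \<otimes>\<^bsub>shift_group G\<^esub> (E, l) = (\<lambda>i. F i \<otimes>\<^bsub>G\<^esub> E (i + k), k + l)"
  "\<one>\<^bsub>shift_group G\<^esub> = (\<lambda>_. \<one>\<^bsub>G\<^esub>, 0)"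
  by (simp_all add: shift_group_def)

lemma (in group) group_shift_group: "group (shift_group G)"
proof (rule groupI)
  fix x assume "x \<in> carrier (shift_group G)"
  moreover obtain F k where x: "x = (F, k)" by force
  ultimately show "\<exists>y\<in>carrier (shift_group G). y \<otimes>\<^bsub>shift_group G\<^esub> x = \<one>\<^bsub>shift_group G\<^esub>"
    by (intro bexI[of _ "(\<lambda>i. inv (F (i - k)), - k)"]) auto
qed (auto simp: m_assoc add.assoc)

lemma (in group) const_hom_shift_group: "(\<lambda>g. (\<lambda>_. g, 0)) \<in> hom G (shift_group G)"
  by (rule homI) auto

text \<open>The product telescopes. In other words, the base element is the pure shift conjugated by
  the sequence with entries x^(s i), so its k-th power is the conjugate of the k-fold shift.\<close>

lemma (in group) shift_group_pow:
  fixes s :: "int \<Rightarrow> int" and k :: nat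
  assumes "x \<in> carrier G"
  shows "(\<lambda>i. x [^] (s (i + 1) - s i), 1) [^]\<^bsub>shift_group G\<^esub> k =
    (\<lambda>i. x [^] (s (i + int k) - s i), int k)"
proof (induction k)
  case (Suc k)
  then show ?case using assms by (simp add: ac_simps flip: int_pow_mult)
qed simp

section \<open>Artin groups with an even leaf\<close>

locale even_leaf =
  fixes \<Gamma> :: "'v labelled_graph" and a b :: 'v and n :: nat
  assumes graph: "defining_graph \<Gamma>"
    and edge: "{a, b} \<in> edges \<Gamma>"
    and leaf: "\<And>e. e \<in> edges \<Gamma> \<Longrightarrow> a \<in> e \<Longrightarrow> e = {a, b}"
    and label: "label \<Gamma> {a, b} = 2 * n"
begin

abbreviation "A \<equiv> artin_group \<Gamma>"
abbreviation "gen \<equiv> artin_gen \<Gamma>"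

lemma edge_verts: "{p, q} \<in> edges \<Gamma> \<Longrightarrow> p \<in> verts \<Gamma> \<and> q \<in> verts \<Gamma>"
  using graph by (auto simp: defining_graph_def)

lemma a_vert: "a \<in> verts \<Gamma>" and b_vert: "b \<in> verts \<Gamma>"
  using edge_verts[OF edge] by auto

lemma a_neq_b: "a \<noteq> b"
  using graph edge by (fastforce simp: defining_graph_def)

lemma n_pos: "n > 0"
  using graph edge label by (fastforce simp: defining_graph_def)

sublocale A: group A
  by (simp add: artin_group_def group_presented_group)

lemma gen_carrier [simp]: "v \<in> verts \<Gamma> \<Longrightarrow> gen v \<in> carrier A"
  by (simp add: artin_gen_def artin_group_def pres_gen_carrier)

lemmas hom_ext = presented_group_hom_ext[of _ _ "verts \<Gamma>" "artin_relations \<Gamma>",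
    folded artin_group_def artin_gen_def]

lemmas artin_lift = presented_group_lift[of _ _ "verts \<Gamma>" "artin_relations \<Gamma>",
    folded artin_group_def artin_gen_def]

lemma hom_relation:
  assumes "group H" "h \<in> hom A H" "{p, q} \<in> edges \<Gamma>"
  shows "word_eval H (\<lambda>v. h (gen v)) (alt_word p q (label \<Gamma> {p, q})) =
    word_eval H (\<lambda>v. h (gen v)) (alt_word q p (label \<Gamma> {p, q}))"
proof -
  let ?l = "alt_word p q (label \<Gamma> {p, q})" and ?r = "alt_word q p (label \<Gamma> {p, q})"
  have w: "?l \<in> words (verts \<Gamma>)" "?r \<in> words (verts \<Gamma>)"
    using edge_verts[OF assms(3)] alt_word_words by metis+
  have "(?l, ?r) \<in> artin_relations \<Gamma>"
    using assms(3) by (auto simp: artin_relations_def)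
  then have "([] @ ?l @ [], [] @ ?r @ []) \<in> pres_eq (verts \<Gamma>) (artin_relations \<Gamma>)"
    using w by (intro pres_eq.relator) auto
  then have "pres_eq (verts \<Gamma>) (artin_relations \<Gamma>) `` {?l} = pres_eq (verts \<Gamma>) (artin_relations \<Gamma>) `` {?r}"
    using equiv_class_eq[OF equiv_pres_eq] by fastforce
  then show ?thesis
    using hom_pres_class[OF assms(1) assms(2)[unfolded artin_group_def]] w
    by (metis artin_gen_def)
qed

section \<open>The leaf relation in terms of \<open>x\<close>, and maps prescribed on
  \<open>x\<close>\<close>

definition x where "x = gen a \<otimes>\<^bsub>A\<^esub> gen b"

lemma x_carrier [simp]: "x \<in> carrier A"
  by (simp add: x_def a_vert b_vert)

lemma gen_a_eq: "gen a = x \<otimes>\<^bsub>A\<^esub> inv\<^bsub>A\<^esub> gen b"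
  by (simp add: x_def a_vert b_vert A.m_assoc)

lemma x_pow_commute: "x [^]\<^bsub>A\<^esub> n \<otimes>\<^bsub>A\<^esub> gen b = gen b \<otimes>\<^bsub>A\<^esub> x [^]\<^bsub>A\<^esub> n"
proof -
  have "(\<lambda>x. x) \<in> hom A A" by (simp add: hom_def)
  from hom_relation[OF A.group_axioms this edge]
  have "(gen a \<otimes>\<^bsub>A\<^esub> gen b) [^]\<^bsub>A\<^esub> n = (gen b \<otimes>\<^bsub>A\<^esub> gen a) [^]\<^bsub>A\<^esub> n"
    by (simp add: label A.word_eval_alt_word_double a_vert b_vert)
  then show ?thesis
    using A.mult_pow_eq_iff_commute a_vert b_vert by (simp add: x_def)
qed

text \<open>With \<open>x\<close> in place of \<open>gen a\<close> as a generator, the only relation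
  that involves \<open>x\<close> says that x^n commutes with \<open>gen b\<close>. Hence
  \<open>x\<close> may go to any \<open>y\<close> satisfying \<open>comm\<close>, while the other
  generators keep their images under \<open>h\<close>.\<close>

lemma leaf_extend:
  assumes H: "group H" and h: "h \<in> hom A H" and y: "y \<in> carrier H"
    and comm: "y [^]\<^bsub>H\<^esub> n \<otimes>\<^bsub>H\<^esub> h (gen b) = h (gen b) \<otimes>\<^bsub>H\<^esub> y [^]\<^bsub>H\<^esub> n"
  obtains k where "k \<in> hom A H" "\<And>v. v \<in> verts \<Gamma> \<Longrightarrow> v \<noteq> a \<Longrightarrow> k (gen v) = h (gen v)"
    "k (gen a) = y \<otimes>\<^bsub>H\<^esub> inv\<^bsub>H\<^esub> h (gen b)" "k x = y"
proof -
  interpret H: group H by fact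
  define f where "f = (\<lambda>v. h (gen v))(a := y \<otimes>\<^bsub>H\<^esub> inv\<^bsub>H\<^esub> h (gen b))"
  have hv: "h (gen v) \<in> carrier H" if "v \<in> verts \<Gamma>" for v
    using h that by (simp add: hom_in_carrier)
  have f_eq: "f v = h (gen v)" if "v \<noteq> a" for v using that by (simp add: f_def)
  have f_verts: "f v \<in> carrier H" if "v \<in> verts \<Gamma>" for v
    using that hv b_vert y by (simp add: f_def)
  then have f: "f \<in> verts \<Gamma> \<rightarrow> carrier H" by blast
  have "f a \<otimes>\<^bsub>H\<^esub> f b = y"
    using a_neq_b y hv[OF b_vert] by (simp add: f_def H.m_assoc)
  then have ab: "(f a \<otimes>\<^bsub>H\<^esub> f b) [^]\<^bsub>H\<^esub> n = (f b \<otimes>\<^bsub>H\<^esub> f a) [^]\<^bsub>H\<^esub> n"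
    using comm a_neq_b f_eq[of b] H.mult_pow_eq_iff_commute[OF f_verts[OF a_vert] f_verts[OF b_vert]]
    by simp
  have "word_eval H f l = word_eval H f r" if "(l, r) \<in> artin_relations \<Gamma>" for l r
  proof -
    obtain p q where l: "l = alt_word p q (label \<Gamma> {p, q})" and r: "r = alt_word q p (label \<Gamma> {p, q})"
      and e: "{p, q} \<in> edges \<Gamma>"
      using \<open>(l, r) \<in> artin_relations \<Gamma>\<close> by (auto simp: artin_relations_def)
    show ?thesis
    proof (cases "a \<in> {p, q}")
      case True
      then have "p = a \<and> q = b \<or> p = b \<and> q = a"
        using leaf[OF e] by (auto simp: doubleton_eq_iff)
      then show ?thesis
        using ab label f_verts a_vert b_vert
        by (auto simp: l r H.word_eval_alt_word_double insert_commute)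
    next
      case False
      \<comment> \<open>A relation of an edge that avoids \<open>a\<close> is inherited from
        \<open>h\<close>.\<close>
      have "f v = h (gen v)" if "(v, c) \<in> set l \<union> set r" for v c
        using that False set_alt_word unfolding l r by (intro f_eq) fastforce
      then have "word_eval H f l = word_eval H (\<lambda>v. h (gen v)) l"
        "word_eval H f r = word_eval H (\<lambda>v. h (gen v)) r"
        by (auto intro!: word_eval_cong)
      then show ?thesis using hom_relation[OF H h e] by (simp add: l r)
    qed
  qed
  then obtain k where k: "k \<in> hom A H" "\<And>v. v \<in> verts \<Gamma> \<Longrightarrow> k (gen v) = f v"
    using artin_lift[OF H f] by blast
  show thesis
  proof
    show "k \<in> hom A H" by fact
    show "k x = y"
      using \<open>f a \<otimes>\<^bsub>H\<^esub> f b = y\<close> k a_vert b_vert by (simp add: x_def hom_mult)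
  qed (use k a_vert in \<open>auto simp: f_def\<close>)
qed

lemma id_hom: "(\<lambda>g. g) \<in> hom A A"
  by (simp add: hom_def)

section \<open>An injective endomorphism that is not surjective\<close>

lemma exists_nonsurjective_injection:
  obtains \<phi> where "\<phi> \<in> hom A A" "inj_on \<phi> (carrier A)" "\<phi> ` carrier A \<noteq> carrier A"
proof -
  let ?Z = "integer_group" and ?W = "shift_group A"
  interpret W: group ?W by (rule A.group_shift_group)
  \<comment> \<open>This choice gives N > 1, which excludes surjectivity, and N congruent to 1
    modulo n, which makes the two demands on \<open>s\<close> compatible.\<close>
  define N where "N = Suc n"
  have "(x [^]\<^bsub>A\<^esub> N) [^]\<^bsub>A\<^esub> n \<otimes>\<^bsub>A\<^esub> gen b = gen b \<otimes>\<^bsub>A\<^esub> (x [^]\<^bsub>A\<^esub> N) [^]\<^bsub>A\<^esub> n"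
    using A.group_commutes_pow[OF x_pow_commute, of N] b_vert
    by (simp add: A.nat_pow_pow mult.commute)
  then obtain \<phi> where \<phi>: "\<phi> \<in> hom A A" "\<And>v. v \<in> verts \<Gamma> \<Longrightarrow> v \<noteq> a \<Longrightarrow> \<phi> (gen v) = gen v"
    "\<phi> (gen a) = x [^]\<^bsub>A\<^esub> N \<otimes>\<^bsub>A\<^esub> inv\<^bsub>A\<^esub> gen b" "\<phi> x = x [^]\<^bsub>A\<^esub> N"
    using leaf_extend[OF A.group_axioms id_hom, of "x [^]\<^bsub>A\<^esub> N"] by auto
  have trivial: "(\<lambda>_. 0) \<in> hom A ?Z" by (simp add: hom_def)
  \<comment> \<open>The exponent sum of \<open>gen a\<close>. The group is additive, so
    \<open>y = 1\<close> is a generator here and not the identity; \<open>comm\<close> holds as the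
    target is abelian.\<close>
  obtain \<chi> where \<chi>: "\<chi> \<in> hom A ?Z" "\<And>v. v \<in> verts \<Gamma> \<Longrightarrow> v \<noteq> a \<Longrightarrow> \<chi> (gen v) = 0"
    "\<chi> (gen a) = 1" "\<chi> x = 1"
    using leaf_extend[OF group_integer_group trivial, of 1] by auto
  have "\<chi> (\<phi> g) = int N * \<chi> g" if "g \<in> carrier A" for g
  proof (rule hom_ext[OF group_integer_group _ _ _ that])
    show "(\<lambda>g. \<chi> (\<phi> g)) \<in> hom A ?Z"
      using hom_compose[OF \<phi>(1) \<chi>(1)] by (simp add: comp_def)
    show "(\<lambda>g. int N * \<chi> g) \<in> hom A ?Z"
      using hom_mult[OF \<chi>(1)] by (simp add: hom_def distrib_left)
    interpret \<chi>: group_hom A ?Z \<chi>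
      using \<chi> by (simp add: group_hom_def group_hom_axioms_def A.group_axioms)
    show "\<chi> (\<phi> (gen v)) = int N * \<chi> (gen v)" if "v \<in> verts \<Gamma>" for v
      using that \<phi> \<chi> a_neq_b b_vert by (cases "v = a") (simp_all add: \<chi>.hom_nat_pow)
  qed
  then have "int N dvd 1" if "\<phi> ` carrier A = carrier A"
    using that \<chi>(3) a_vert by (metis dvd_triv_left gen_carrier imageE)
  then have nonsurj: "\<phi> ` carrier A \<noteq> carrier A"
    using n_pos by (auto simp: N_def)

  \<comment> \<open>Subtracting multiples of n keeps the residue modulo n, and s (N j) = N j - n j =
    j.\<close>
  define s :: "int \<Rightarrow> int" where "s i = i - int n * (i div int N)" for i
  \<comment> \<open>Sending \<open>x\<close> to \<open>(c, 1)\<close> and each v other than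
    \<open>a\<close> to a constant sequence sends the conjugate of v by x^i to the sequence whose
    entry at j is v conjugated by x^(s (i + j) - s j). As s 0 = 0, the entry at 0 is the left
    inverse sought on the kernel of \<open>\<chi>\<close>.\<close>
  define c where "c = (\<lambda>i. x [^]\<^bsub>A\<^esub> (s (i + 1) - s i))"
  have c_pow: "(c, 1) [^]\<^bsub>?W\<^esub> k = (\<lambda>i. x [^]\<^bsub>A\<^esub> (s (i + int k) - s i), int k)" for k :: nat
    unfolding c_def by (rule A.shift_group_pow) simp
  have s_N: "s (i + int N) - s i = 1" for i
  proof -
    have "(i + int N) div int N = i div int N + 1"
      using div_add_self2[of "int N" i] by (simp add: N_def)
    then show ?thesis by (simp add: s_def N_def algebra_simps)
  qed
  \<comment> \<open>The exponent is a multiple of n, so this is a power of x^n, which commutes with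
    \<open>gen b\<close>.\<close>
  have "x [^]\<^bsub>A\<^esub> (s (i + int n) - s i) \<otimes>\<^bsub>A\<^esub> gen b = gen b \<otimes>\<^bsub>A\<^esub> x [^]\<^bsub>A\<^esub> (s (i + int n) - s i)" for i
  proof -
    have "s (i + int n) - s i = int n * (1 - (i + int n) div int N + i div int N)"
      by (simp add: s_def algebra_simps)
    then show ?thesis
      using A.int_pow_commute[OF _ _ x_pow_commute] b_vert
      by (simp add: int_pow_int flip: A.int_pow_pow)
  qed
  then have c_commute: "(c, 1) [^]\<^bsub>?W\<^esub> n \<otimes>\<^bsub>?W\<^esub> (\<lambda>_. gen b, 0) = (\<lambda>_. gen b, 0) \<otimes>\<^bsub>?W\<^esub> (c, 1) [^]\<^bsub>?W\<^esub> n"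
    by (simp add: c_pow)
  have c_W: "(c, 1) \<in> carrier ?W" by (simp add: c_def)
  obtain \<theta> where \<theta>: "\<theta> \<in> hom A ?W" "\<And>v. v \<in> verts \<Gamma> \<Longrightarrow> v \<noteq> a \<Longrightarrow> \<theta> (gen v) = (\<lambda>_. gen v, 0)"
    "\<theta> x = (c, 1)"
    using leaf_extend[OF A.group_shift_group A.const_hom_shift_group c_W c_commute] by metis
  interpret \<theta>: group_hom A ?W \<theta>
    using \<theta> by (simp add: group_hom_def group_hom_axioms_def A.group_axioms W.group_axioms)
  interpret \<chi>: group_hom A ?Z \<chi>
    using \<chi> by (simp add: group_hom_def group_hom_axioms_def A.group_axioms)
  \<comment> \<open>It suffices to compare generators. The essential case is \<open>x\<close>: its
    image under \<open>\<phi>\<close> is x^N, and \<open>(c, 1)\<close> to the power N is the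
    constant sequence x with shift N, by \<open>s_N\<close>. Injectivity of \<open>\<phi>\<close> is
    then read off from the first component.\<close>
  have "\<theta> (\<phi> g) = (\<lambda>_. g, int N * \<chi> g)" if "g \<in> carrier A" for g
  proof (rule hom_ext[OF A.group_shift_group _ _ _ that])
    show "(\<lambda>g. \<theta> (\<phi> g)) \<in> hom A ?W"
      using hom_compose[OF \<phi>(1) \<theta>(1)] by (simp add: comp_def)
    show "(\<lambda>g. (\<lambda>_. g, int N * \<chi> g)) \<in> hom A ?W"
      by (simp add: hom_def distrib_left)
    have inv_b: "inv\<^bsub>?W\<^esub> (\<lambda>_. gen b, 0) = (\<lambda>_. inv\<^bsub>A\<^esub> gen b, 0)"
      using b_vert by (intro W.inv_equality) auto
    show "\<theta> (\<phi> (gen v)) = (\<lambda>_. gen v, int N * \<chi> (gen v))" if "v \<in> verts \<Gamma>" for v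
    proof (cases "v = a")
      case True
      have "\<theta> (\<phi> (gen a)) = (c, 1) [^]\<^bsub>?W\<^esub> N \<otimes>\<^bsub>?W\<^esub> inv\<^bsub>?W\<^esub> (\<lambda>_. gen b, 0)"
        using \<phi>(3) \<theta> a_neq_b b_vert by (simp add: \<theta>.hom_nat_pow)
      also have "\<dots> = (\<lambda>_. gen a, int N)"
        by (simp add: inv_b c_pow s_N gen_a_eq)
      finally show ?thesis using True \<chi>(3) by simp
    next
      case False
      then show ?thesis using that \<phi>(2) \<theta>(2) \<chi>(2) by simp
    qed
  qed
  then have "inj_on \<phi> (carrier A)"
    by (metis (mono_tags, lifting) fst_conv inj_onI)
  with \<phi>(1) nonsurj that show thesis by blast
qed

section \<open>An automorphism that does not preserve spherical parabolic subgroups\<close>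

lemma length_hom:
  obtains l where "l \<in> hom A integer_group" "\<And>v. v \<in> verts \<Gamma> \<Longrightarrow> l (gen v) = 1"
proof -
  \<comment> \<open>Both sides of an Artin relation are positive words of the same length.\<close>
  have "word_eval integer_group (\<lambda>_. 1) (alt_word p q k) = int k" for p q :: 'v and k
    by (induction p q k rule: alt_word.induct) auto
  then have "word_eval integer_group (\<lambda>_. 1) l = word_eval integer_group (\<lambda>_. 1) r"
    if "(l, r) \<in> artin_relations \<Gamma>" for l r
    using that by (auto simp: artin_relations_def)
  with artin_lift[OF group_integer_group, of "\<lambda>_. 1"] that show thesis by auto
qed

text \<open>This makes the subgroup generated by \<open>gen a\<close> spherical. The single
  generator is its own inverse, so every word evaluates to it or to the identity.\<close>

lemma finite_coxeter_singleton: "finite (carrier (coxeter_group (induced_subgraph \<Gamma> {v})))"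
proof -
  define R where "R = artin_relations (induced_subgraph \<Gamma> {v}) \<union> {([(s, True), (s, True)], []) |s. s \<in> {v}}"
  let ?G = "presented_group {v} R"
  interpret G: group ?G by (rule group_presented_group)
  let ?g = "pres_gen {v} R v"
  have g: "?g \<in> carrier ?G" by (simp add: pres_gen_carrier)
  have "([] @ [(v, True), (v, True)] @ [], [] @ [] @ []) \<in> pres_eq {v} R"
    by (intro pres_eq.relator) (auto simp: R_def)
  then have "pres_eq {v} R `` {[(v, True), (v, True)]} = pres_eq {v} R `` {[]}"
    using equiv_class_eq[OF equiv_pres_eq] by fastforce
  then have gg: "?g \<otimes>\<^bsub>?G\<^esub> ?g = \<one>\<^bsub>?G\<^esub>"
    by (simp add: pres_gen_def presented_group_mult_class) (simp add: presented_group_def)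
  then have ginv: "inv\<^bsub>?G\<^esub> ?g = ?g" using g by (simp add: G.inv_equality)
  have "word_eval ?G (pres_gen {v} R) w \<in> {\<one>\<^bsub>?G\<^esub>, ?g}" if "w \<in> words {v}" for w
    using that
  proof (induction w)
    case (Cons x w)
    then obtain c where "x = (v, c)" by auto
    then have "word_eval ?G (pres_gen {v} R) (x # w) = ?g \<otimes>\<^bsub>?G\<^esub> word_eval ?G (pres_gen {v} R) w"
      using ginv by simp
    moreover have "word_eval ?G (pres_gen {v} R) w = \<one>\<^bsub>?G\<^esub> \<or> word_eval ?G (pres_gen {v} R) w = ?g"
      using Cons by simp
    ultimately show ?case using g gg by (elim disjE) simp_all
  qed simp
  then have "carrier ?G \<subseteq> {\<one>\<^bsub>?G\<^esub>, ?g}"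
    by (metis presented_group_cases presented_group_eval subsetI)
  then have "finite (carrier ?G)" by (rule finite_subset) simp
  then show ?thesis by (simp add: coxeter_group_def R_def induced_subgraph_def)
qed

lemma exists_nonparabolic_automorphism:
  obtains \<psi> P where "\<psi> \<in> iso A A" "P \<in> spherical_parabolic_subgroups \<Gamma>"
    "\<psi> ` P \<notin> spherical_parabolic_subgroups \<Gamma>"
proof -
  have "(inv\<^bsub>A\<^esub> x) [^]\<^bsub>A\<^esub> n \<otimes>\<^bsub>A\<^esub> gen b = gen b \<otimes>\<^bsub>A\<^esub> (inv\<^bsub>A\<^esub> x) [^]\<^bsub>A\<^esub> n"
    using A.inv_commute[OF _ _ x_pow_commute] b_vert by (simp add: A.nat_pow_inv)
  then obtain \<psi> where \<psi>: "\<psi> \<in> hom A A" "\<And>v. v \<in> verts \<Gamma> \<Longrightarrow> v \<noteq> a \<Longrightarrow> \<psi> (gen v) = gen v"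
    "\<psi> (gen a) = inv\<^bsub>A\<^esub> x \<otimes>\<^bsub>A\<^esub> inv\<^bsub>A\<^esub> gen b" "\<psi> x = inv\<^bsub>A\<^esub> x"
    using leaf_extend[OF A.group_axioms id_hom, of "inv\<^bsub>A\<^esub> x"] by auto
  interpret \<psi>: group_hom A A \<psi>
    using \<psi> by (simp add: group_hom_def group_hom_axioms_def A.group_axioms)
  have "\<psi> (\<psi> g) = g" if "g \<in> carrier A" for g
  proof (rule hom_ext[OF A.group_axioms _ id_hom _ that])
    show "(\<lambda>g. \<psi> (\<psi> g)) \<in> hom A A"
      using hom_compose[OF \<psi>(1) \<psi>(1)] by (simp add: comp_def)
    show "\<psi> (\<psi> (gen v)) = gen v" if "v \<in> verts \<Gamma>" for v
    proof (cases "v = a")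
      case True
      \<comment> \<open>Applying \<open>\<psi>\<close> twice inverts \<open>x\<close> twice and
        fixes \<open>gen b\<close>, and \<open>gen a\<close> is the product of \<open>x\<close> and
        the inverse of \<open>gen b\<close>.\<close>
      then show ?thesis using \<psi> a_neq_b b_vert by (simp add: gen_a_eq)
    qed (use that \<psi>(2) in simp)
  qed
  then have "bij_betw \<psi> (carrier A) (carrier A)"
    by (intro bij_betwI[where g = \<psi>]) auto
  with \<psi>(1) have iso: "\<psi> \<in> iso A A" by (simp add: iso_def)

  obtain l where l: "l \<in> hom A integer_group" "\<And>v. v \<in> verts \<Gamma> \<Longrightarrow> l (gen v) = 1"
    by (rule length_hom) blast
  interpret l: group_hom A integer_group l
    using l by (simp add: group_hom_def group_hom_axioms_def A.group_axioms)
  let ?P = "standard_parabolic \<Gamma> {a}"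
  have P_carrier: "?P \<subseteq> carrier A"
    using a_vert by (simp add: standard_parabolic_def A.generate_incl)
  \<comment> \<open>The image of \<open>gen a\<close> is a product of three inverse
    generators.\<close>
  have l_a: "l (\<psi> (gen a)) = -3"
    using l(2) a_vert b_vert by (simp add: \<psi>(3)) (simp add: x_def)
  have dvd: "3 dvd l (\<psi> g)" if "g \<in> ?P" for g
    using that[unfolded standard_parabolic_def]
  proof (induction rule: generate.induct)
    case (eng g h)
    then show ?case
      using P_carrier by (simp add: standard_parabolic_def subset_iff)
  qed (use l_a a_vert in auto)
  have a_P: "gen a \<in> ?P" by (simp add: standard_parabolic_def generate.incl)

  \<comment> \<open>The standard subgroup is exhibited as its own conjugate by the identity.\<close>
  have "\<one>\<^bsub>A\<^esub> <#\<^bsub>A\<^esub> ?P #>\<^bsub>A\<^esub> inv\<^bsub>A\<^esub> \<one>\<^bsub>A\<^esub> = ?P"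
    using P_carrier by (simp add: A.lcos_mult_one A.coset_mult_one)
  then have "?P \<in> spherical_parabolic_subgroups \<Gamma>"
    using a_vert finite_coxeter_singleton[of a] unfolding spherical_parabolic_subgroups_def
    by (smt (verit, best) A.one_closed bot_least insert_subset mem_Collect_eq)
  moreover have "\<psi> ` ?P \<notin> spherical_parabolic_subgroups \<Gamma>"
  proof
    assume "\<psi> ` ?P \<in> spherical_parabolic_subgroups \<Gamma>"
    then obtain g U where g: "g \<in> carrier A" and U: "U \<subseteq> verts \<Gamma>"
      and eq: "\<psi> ` ?P = g <#\<^bsub>A\<^esub> standard_parabolic \<Gamma> U #>\<^bsub>A\<^esub> inv\<^bsub>A\<^esub> g"
      by (auto simp: spherical_parabolic_subgroups_def)
    show False
    proof (cases "U = {}")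
      \<comment> \<open>The empty set supplies no generator of length 1. Its subgroup is trivial,
        which is excluded because \<open>\<psi> (gen a)\<close> has nonzero length.\<close>
      case True
      then have "\<psi> (gen a) = \<one>\<^bsub>A\<^esub>"
        using a_P eq g by (auto simp: standard_parabolic_def A.generate_empty l_coset_def r_coset_def)
      then show False using l_a by simp
    next
      case False
      then obtain u where u: "u \<in> U" by blast
      then have "gen u \<in> standard_parabolic \<Gamma> U" by (simp add: standard_parabolic_def generate.incl)
      then have "g \<otimes>\<^bsub>A\<^esub> gen u \<otimes>\<^bsub>A\<^esub> inv\<^bsub>A\<^esub> g \<in> \<psi> ` ?P"
        by (auto simp: eq l_coset_def r_coset_def)
      \<comment> \<open>Length is invariant under conjugation, so this would make 3 divide
        1.\<close>
      then have "3 dvd l (g \<otimes>\<^bsub>A\<^esub> gen u \<otimes>\<^bsub>A\<^esub> inv\<^bsub>A\<^esub> g)"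
        using dvd by auto
      then show False using g u U l(2) by (auto simp: subset_iff)
    qed
  qed
  ultimately show thesis using iso that by blast
qed

end

theorem theoremH:
  fixes \<Gamma> :: "'v labelled_graph"
  assumes "defining_graph \<Gamma>"
    and "\<exists>e. is_leaf \<Gamma> e \<and> even (label \<Gamma> e)"
  shows "(\<exists>\<phi>\<in>iso (artin_group \<Gamma>) (artin_group \<Gamma>).
            \<not> (\<forall>P\<in>spherical_parabolic_subgroups \<Gamma>. \<phi> ` P \<in> spherical_parabolic_subgroups \<Gamma>))
       \<and> \<not> co_Hopfian (artin_group \<Gamma>)"
proof -
  obtain e a where e: "e \<in> edges \<Gamma>" "a \<in> e" "even (label \<Gamma> e)"
    and leaf: "\<And>e'. e' \<in> edges \<Gamma> \<Longrightarrow> a \<in> e' \<Longrightarrow> e' = e"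
    using assms(2) unfolding is_leaf_def by blast
  obtain b where b: "e = {a, b}"
  proof -
    have "card e = 2" using assms(1) e(1) by (simp add: defining_graph_def)
    then obtain c d where "e = {c, d}" by (auto simp: card_2_iff)
    then show thesis using that e(2) by (metis insert_commute insertE singletonD)
  qed
  obtain n where n: "label \<Gamma> e = 2 * n" using e(3) by blast
  interpret even_leaf \<Gamma> a b n
    using assms(1) e(1) leaf n unfolding b by unfold_locales
  show ?thesis
  proof
    show "\<exists>\<phi>\<in>iso A A. \<not> (\<forall>P\<in>spherical_parabolic_subgroups \<Gamma>. \<phi> ` P \<in> spherical_parabolic_subgroups \<Gamma>)"
      by (rule exists_nonparabolic_automorphism) blast
    show "\<not> co_Hopfian A"
      unfolding co_Hopfian_def by (rule exists_nonsurjective_injection) blast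
  qed
qed

end
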